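(* Let $\Sigma$ be the surface of a centrally symmetric convex polyhedron, with farthest point map $F$, antipodal map $\phi$, and $f=F\circ\phi$. Then $f$ has no generalized periodic points; that is, there is no point $p\in\Sigma$ for which there exists an integer $n>1$ with $p\in f^n(p)$ and $p\notin f^m(p)$ for all $1\le m<n$.
   Context: $\Sigma\subset\mathbb{R}^3$ is the boundary surface of a convex polyhedron that is symmetric about the origin, equipped with its intrinsic path metric $\operatorname{dist}$. $\phi:\Sigma\to\Sigma$, $\phi(x)=-x$, is the antipodal map. For $p\in\Sigma$, $F(p)$ is the (nonempty) set of all $q\in\Sigma$ at which $\operatorname{dist}(p,\cdot)$ attains its maximum. $f(p):=F(\phi(p))\subset\Sigma$. $F$ and $f$ are set-valued; iterates are defined by $f^1=f$ and $f^{n}(p)=\bigcup_{q\in f^{n-1}(p)}f(q)$. If $n$ is a positive integer with $p\in f^n(p)$ and $p\notin f^m(p)$ for all positive integers $m<n$, then $p$ is called a generalized periodic point of $f$ of order $n$ if $n>1$, and a generalized fixed point of $f$ if $n=1$. *)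

theory Defs
  imports "HOL-Analysis.Analysis"
begin

text \<open>The length of a curve on \<open>[0, 1]\<close>, possibly infinite: the supremum of the lengths of the
  inscribed polygonal lines with vertices \<open>g (t 0), \<dots>, g (t n)\<close> at parameters
  \<open>0 \<le> t 0 \<le> \<dots> \<le> t n \<le> 1\<close>.\<close>

definition path_length :: "(real \<Rightarrow> 'a::metric_space) \<Rightarrow> ennreal" where
  "path_length g =
     (SUP (n, t) \<in> {(n :: nat, t :: nat \<Rightarrow> real). mono_on {..n} t \<and> t ` {..n} \<subseteq> {0..1}}.
        \<Sum>i<n. ennreal (dist (g (t i)) (g (t (Suc i)))))"

text \<open>The intrinsic path metric of \<open>S\<close>. It takes values in the extended nonnegative reals, so that
  no junk value is needed for points that are not joined by a curve of finite length in \<open>S\<close>.\<close>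

definition intrinsic_dist :: "'a::metric_space set \<Rightarrow> 'a \<Rightarrow> 'a \<Rightarrow> ennreal" where
  "intrinsic_dist S p q =
     (INF g \<in> {g. path g \<and> path_image g \<subseteq> S \<and> pathstart g = p \<and> pathfinish g = q}. path_length g)"

definition farthest_points :: "'a::metric_space set \<Rightarrow> 'a \<Rightarrow> 'a set" where
  "farthest_points S p =
     {q \<in> S. \<forall>r\<in>S. intrinsic_dist S p r \<le> intrinsic_dist S p q}"

definition antipodal_map :: "'a::real_normed_vector \<Rightarrow> 'a" where
  "antipodal_map x = - x"

definition farthest_antipodal :: "'a::real_normed_vector set \<Rightarrow> 'a \<Rightarrow> 'a set" where
  "farthest_antipodal S p = farthest_points S (antipodal_map p)"

text \<open>Iterates of a set-valued map; the value at \<open>0\<close> is chosen so that the first iterate is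
  the map itself.\<close>

primrec set_iterate :: "('a \<Rightarrow> 'a set) \<Rightarrow> nat \<Rightarrow> 'a \<Rightarrow> 'a set" where
  "set_iterate f 0 p = {p}"
| "set_iterate f (Suc n) p = (\<Union>q \<in> set_iterate f n p. f q)"

lemma set_iterate_1: "set_iterate f 1 p = f p"
  by simp

definition generalized_periodic_point :: "('a \<Rightarrow> 'a set) \<Rightarrow> nat \<Rightarrow> 'a \<Rightarrow> bool" where
  "generalized_periodic_point f n p \<longleftrightarrow>
     n > 1 \<and> p \<in> set_iterate f n p \<and> (\<forall>m. 1 \<le> m \<and> m < n \<longrightarrow> p \<notin> set_iterate f m p)"

end

theory Submission
  imports Defs "HOL-Complex_Analysis.Riemann_Mapping"
begin

text \<open>
  Let \<open>d\<close> be the intrinsic metric. If \<open>q \<in> f p\<close> and \<open>r \<in> f q\<close>, then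
  \<open>d(-p, q) = d(-q, p) \<le> d(-q, r)\<close>, so the farthest distance does not decrease along an orbit;
  on a periodic orbit it is a constant \<open>D\<close>. Let \<open>p\<close> be periodic but not fixed and \<open>q \<in> f p\<close> the next
  point of its orbit. Then \<open>d(-p, q) = d(-q, p) = D\<close>, \<open>d(-q, q) \<le> D\<close> and \<open>d(-p, p) < D\<close>. A curve from
  \<open>-p\<close> to \<open>p\<close> meets each curve from \<open>-q\<close> to \<open>q\<close> or its antipodal image, as non-contractible loops of
  the projective plane intersect. Exchanging the curves at the intersection point gives
  \<open>2 D \<le> d(-p, p) + d(-q, q) < 2 D\<close>, because \<open>D\<close> is finite.
\<close>

subsection \<open>Length of curves\<close>

lemma path_length_upper:
  assumes "mono_on {..n} t" "t ` {..n} \<subseteq> {0..1}"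
  shows "(\<Sum>i<n. ennreal (dist (g (t i)) (g (t (Suc i))))) \<le> path_length g"
  unfolding path_length_def using assms by (intro SUP_upper2[of "(n, t)"]) auto

lemma path_length_least:
  assumes "\<And>n t. mono_on {..n} t \<Longrightarrow> t ` {..n} \<subseteq> {0..1} \<Longrightarrow>
    (\<Sum>i<n. ennreal (dist (g (t i)) (g (t (Suc i))))) \<le> L"
  shows "path_length g \<le> L"
  unfolding path_length_def using assms by (intro SUP_least) auto

lemma path_length_isometry:
  assumes "\<And>x y. dist (f x) (f y) = dist x y"
  shows "path_length (f \<circ> g) = path_length g"
  unfolding path_length_def by (simp add: assms)

lemma path_length_lipschitz_le:
  assumes g: "C-lipschitz_on {0..1} g"
  shows "path_length g \<le> ennreal C"
proof (rule path_length_least)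
  fix n :: nat and t :: "nat \<Rightarrow> real" assume t: "mono_on {..n} t" "t ` {..n} \<subseteq> {0..1}"
  have C: "C \<ge> 0" using g lipschitz_on_nonneg by blast
  have step: "t i \<le> t (Suc i)" "t i \<in> {0..1}" "t (Suc i) \<in> {0..1}" if "i < n" for i
    using that t(2) by (auto simp: image_subset_iff intro: mono_onD[OF t(1)])
  have "(\<Sum>i<n. dist (g (t i)) (g (t (Suc i)))) \<le> (\<Sum>i<n. C * (t (Suc i) - t i))"
  proof (rule sum_mono)
    fix i assume "i \<in> {..<n}"
    then show "dist (g (t i)) (g (t (Suc i))) \<le> C * (t (Suc i) - t i)"
      using lipschitz_onD[OF g, of "t i" "t (Suc i)"] step[of i]
      by (simp add: dist_real_def)
  qed
  also have "\<dots> = C * (t n - t 0)"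
    by (simp add: sum_lessThan_telescope flip: sum_distrib_left)
  also have "\<dots> \<le> C * 1"
  proof (rule mult_left_mono)
    have "t n \<in> {0..1}" "t 0 \<in> {0..1}" using t(2) by auto
    then show "t n - t 0 \<le> 1" by simp
  qed (rule C)
  finally show "(\<Sum>i<n. ennreal (dist (g (t i)) (g (t (Suc i))))) \<le> ennreal C"
    by (simp add: sum_ennreal ennreal_leI)
qed

lemma path_length_reversepath_le: "path_length (reversepath g) \<le> path_length g"
proof (rule path_length_least)
  fix n :: nat and t :: "nat \<Rightarrow> real" assume t: "mono_on {..n} t" "t ` {..n} \<subseteq> {0..1}"
  define u where "u i = 1 - t (n - i)" for i
  have "(\<Sum>i<n. ennreal (dist (reversepath g (t i)) (reversepath g (t (Suc i)))))
      = (\<Sum>i<n. ennreal (dist (reversepath g (t (n - Suc i))) (reversepath g (t (Suc (n - Suc i))))))"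
    by (rule sum.nat_diff_reindex[symmetric])
  also have "\<dots> = (\<Sum>i<n. ennreal (dist (g (u i)) (g (u (Suc i)))))"
    by (intro sum.cong) (auto simp: u_def reversepath_def dist_commute Suc_diff_Suc)
  also have "\<dots> \<le> path_length g"
  proof (rule path_length_upper)
    show "mono_on {..n} u"
      by (rule mono_onI) (auto simp: u_def intro!: mono_onD[OF t(1)])
    show "u ` {..n} \<subseteq> {0..1}"
    proof safe
      fix i
      have "t (n - i) \<in> {0..1}" using t(2) by (auto simp: image_subset_iff)
      then show "u i \<in> {0..1}" by (simp add: u_def)
    qed
  qed
  finally show "(\<Sum>i<n. ennreal (dist (reversepath g (t i)) (reversepath g (t (Suc i)))))
      \<le> path_length g" .
qed

lemma path_length_join_le:
  assumes "pathfinish g1 = pathstart g2"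
  shows "path_length (g1 +++ g2) \<le> path_length g1 + path_length g2"
proof (rule path_length_least)
  fix n :: nat and t :: "nat \<Rightarrow> real" assume t: "mono_on {..n} t" "t ` {..n} \<subseteq> {0..1}"
  \<comment> \<open>Clamping the parameters replaces a refinement of the partition at
    \<open>1/2\<close>: before the junction \<open>b\<close> stays at \<open>0\<close>, after it
    \<open>a\<close> stays at \<open>1\<close>. The one step that may straddle the junction is split
    by the triangle inequality at the common point \<open>g1 1 = g2 0\<close>.\<close>
  define a b where "a i = min 1 (2 * t i)" and "b i = max 0 (2 * t i - 1)" for i
  let ?d = "\<lambda>g t i. dist (g (t i)) (g (t (Suc i)))"
  have "(\<Sum>i<n. ennreal (?d (g1 +++ g2) t i)) \<le> (\<Sum>i<n. ennreal (?d g1 a i) + ennreal (?d g2 b i))"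
  proof (rule sum_mono)
    fix i assume "i \<in> {..<n}"
    then have le: "t i \<le> t (Suc i)" by (auto intro: mono_onD[OF t(1)])
    have eq: "g1 1 = g2 0" using assms by (simp add: pathfinish_def pathstart_def)
    consider "t (Suc i) \<le> 1/2" | "t i \<le> 1/2" "t (Suc i) > 1/2" | "t i > 1/2" by linarith
    then have "?d (g1 +++ g2) t i \<le> ?d g1 a i + ?d g2 b i"
    proof cases
      case 1
      then have "a i = 2 * t i" "a (Suc i) = 2 * t (Suc i)" using le by (auto simp: a_def)
      then show ?thesis using 1 le by (simp add: joinpaths_def)
    next
      case 2
      then have "a i = 2 * t i" "a (Suc i) = 1" "b i = 0" "b (Suc i) = 2 * t (Suc i) - 1"
        by (auto simp: a_def b_def)
      then have "(g1 +++ g2) (t i) = g1 (a i)" "(g1 +++ g2) (t (Suc i)) = g2 (b (Suc i))"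
        "g1 (a (Suc i)) = g2 (b i)"
        using 2 eq by (auto simp: joinpaths_def)
      then show ?thesis by (metis dist_triangle)
    next
      case 3
      then show ?thesis using le by (simp add: joinpaths_def a_def b_def max_def)
    qed
    then show "ennreal (?d (g1 +++ g2) t i) \<le> ennreal (?d g1 a i) + ennreal (?d g2 b i)"
      by (simp add: ennreal_leI flip: ennreal_plus)
  qed
  also have "\<dots> = (\<Sum>i<n. ennreal (?d g1 a i)) + (\<Sum>i<n. ennreal (?d g2 b i))"
    by (rule sum.distrib)
  also have "\<dots> \<le> path_length g1 + path_length g2"
  proof (intro add_mono path_length_upper)
    show "mono_on {..n} a" "mono_on {..n} b"
      using t(1) by (fastforce simp: mono_on_def a_def b_def min_def max_def)+
    show "a ` {..n} \<subseteq> {0..1}" "b ` {..n} \<subseteq> {0..1}"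
      using t(2) by (fastforce simp: a_def b_def)+
  qed
  finally show "(\<Sum>i<n. ennreal (?d (g1 +++ g2) t i)) \<le> path_length g1 + path_length g2" .
qed

lemma sum_lessThan_add: "(\<Sum>i<n + k. f i) = (\<Sum>i<n. f i) + (\<Sum>i<k. f (n + i))"
  for f :: "nat \<Rightarrow> 'a::comm_monoid_add"
  by (induction k) (simp_all add: add.assoc)

lemma path_length_subpaths_le:
  assumes s: "s \<in> {0..1}"
  shows "path_length (subpath 0 s g) + path_length (subpath s 1 g) \<le> path_length g"
proof -
  let ?M = "{(n :: nat, t :: nat \<Rightarrow> real). mono_on {..n} t \<and> t ` {..n} \<subseteq> {0..1}}"
  let ?S = "\<lambda>g (n, t). \<Sum>i<n. ennreal (dist (g (t i)) (g (t (Suc i))))"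
  let ?g1 = "subpath 0 s g" and ?g2 = "subpath s 1 g"
  have ne: "?M \<noteq> {}"
    by (rule ex_in_conv[THEN iffD1], rule exI[of _ "(0, \<lambda>_. 0)"]) (auto simp: mono_on_def)
  have main: "?S ?g1 x + ?S ?g2 y \<le> path_length g" if "x \<in> ?M" "y \<in> ?M" for x y
  proof -
    obtain n a m b where x: "x = (n, a)" and y: "y = (m, b)" by (metis surj_pair)
    have a: "mono_on {..n} a" "\<And>i. i \<le> n \<Longrightarrow> a i \<in> {0..1}" and
      b: "mono_on {..m} b" "\<And>i. i \<le> m \<Longrightarrow> b i \<in> {0..1}"
      using that by (auto simp: x y)
    \<comment> \<open>The partition \<open>a\<close> is rescaled to \<open>[0, s]\<close> and
      \<open>b\<close> to \<open>[s, 1]\<close>. Index \<open>Suc n\<close> carries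
      \<open>b 0\<close>, so the concatenation has one additional edge, from \<open>c n\<close> to
      \<open>c (Suc n)\<close>; its length is nonnegative and is dropped at the end.\<close>
    define c where "c i = (if i \<le> n then s * a i else s + (1 - s) * b (i - Suc n))" for i
    have c_le: "c i \<le> s" "0 \<le> c i" if "i \<le> n" for i
      using that s a(2)[OF that] by (auto simp: c_def mult_left_le)
    have c_ge: "c i \<ge> s" "c i \<le> 1" if "i > n" "i \<le> n + Suc m" for i
    proof -
      have "b (i - Suc n) \<in> {0..1}" using that by (intro b(2)) auto
      then have "0 \<le> (1 - s) * b (i - Suc n)" "(1 - s) * b (i - Suc n) \<le> 1 - s"
        using s by (auto simp: mult_left_le)
      with that show "c i \<ge> s" "c i \<le> 1" by (auto simp: c_def)
    qed
    have "mono_on {..n + Suc m} c"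
    proof (rule mono_onI)
      fix i j assume ij: "i \<in> {..n + Suc m}" "j \<in> {..n + Suc m}" "i \<le> j"
      consider "j \<le> n" | "i \<le> n" "j > n" | "i > n" by linarith
      then show "c i \<le> c j"
      proof cases
        case 1
        then show ?thesis using ij s mono_onD[OF a(1), of i j]
          by (auto simp: c_def intro!: mult_left_mono)
      next
        case 2
        then show ?thesis using c_le[of i] c_ge[of j] ij by auto
      next
        case 3
        then have "b (i - Suc n) \<le> b (j - Suc n)" using ij by (intro mono_onD[OF b(1)]) auto
        then show ?thesis using 3 ij s by (auto simp: c_def intro!: mult_left_mono)
      qed
    qed
    moreover have "c ` {..n + Suc m} \<subseteq> {0..1}"
    proof (clarsimp)
      fix i assume "i \<le> Suc (n + m)"
      then show "0 \<le> c i \<and> c i \<le> 1"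
        using c_le[of i] c_ge[of i] s by (cases "i \<le> n") auto
    qed
    ultimately have "?S g (n + Suc m, c) \<le> path_length g"
      by (simp only: prod.case) (rule path_length_upper)
    moreover have "?S g (n + Suc m, c) = ?S ?g1 x + (ennreal (dist (g (c n)) (g (c (Suc n)))) + ?S ?g2 y)"
    proof -
      have "?S g (n, c) = ?S ?g1 x"
        by (auto simp: x c_def subpath_def intro!: sum.cong)
      moreover have "(\<Sum>i<m. ennreal (dist (g (c (n + Suc i))) (g (c (Suc (n + Suc i)))))) = ?S ?g2 y"
        by (auto simp: y c_def subpath_def algebra_simps intro!: sum.cong)
      ultimately show ?thesis
        unfolding prod.case sum_lessThan_add sum.lessThan_Suc_shift by simp
    qed
    ultimately show ?thesis
      by (metis (no_types, lifting) add.left_commute add_increasing order_refl order_trans zero_le)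
  qed
  \<comment> \<open>A constant may be moved into a supremum in \<open>ennreal\<close> only over a
    nonempty index set, hence \<open>ne\<close>.\<close>
  have "path_length ?g1 + path_length ?g2 = (SUP x\<in>?M. SUP y\<in>?M. ?S ?g1 x + ?S ?g2 y)"
    unfolding path_length_def
    by (simp only: ennreal_SUP_add_right[OF ne, symmetric] ennreal_SUP_add_left[OF ne, symmetric])
  also have "\<dots> \<le> path_length g"
    using main by (intro SUP_least) auto
  finally show ?thesis .
qed

subsection \<open>The intrinsic metric\<close>

lemma intrinsic_dist_le:
  assumes "path g" "path_image g \<subseteq> S" "pathstart g = p" "pathfinish g = q"
  shows "intrinsic_dist S p q \<le> path_length g"
  unfolding intrinsic_dist_def using assms by (intro INF_lower) auto

lemma intrinsic_dist_greatest:
  assumes "\<And>g. path g \<Longrightarrow> path_image g \<subseteq> S \<Longrightarrow> pathstart g = p \<Longrightarrow> pathfinish g = q \<Longrightarrow> L \<le> path_length g"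
  shows "L \<le> intrinsic_dist S p q"
  unfolding intrinsic_dist_def using assms by (intro INF_greatest) auto

lemma intrinsic_dist_commute: "intrinsic_dist S p q = intrinsic_dist S q p"
proof -
  have "intrinsic_dist S p q \<le> intrinsic_dist S q p" for p q
  proof (rule intrinsic_dist_greatest)
    fix g assume "path g" "path_image g \<subseteq> S" "pathstart g = q" "pathfinish g = p"
    then have "intrinsic_dist S p q \<le> path_length (reversepath g)"
      by (intro intrinsic_dist_le) auto
    also have "\<dots> \<le> path_length g" by (rule path_length_reversepath_le)
    finally show "intrinsic_dist S p q \<le> path_length g" .
  qed
  then show ?thesis by (intro antisym)
qed

text \<open>Reduces a bound on a sum of two distances to a bound for arbitrary pairs of curves,
  whether or not shortest curves exist: each curve is chosen within \<open>e / 2\<close> of its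
  infimum. An infinite sum is trivial.\<close>

lemma intrinsic_dist_add_greatest:
  assumes "\<And>g h. path g \<Longrightarrow> path_image g \<subseteq> S \<Longrightarrow> pathstart g = p \<Longrightarrow> pathfinish g = q \<Longrightarrow>
    path h \<Longrightarrow> path_image h \<subseteq> S \<Longrightarrow> pathstart h = r \<Longrightarrow> pathfinish h = s \<Longrightarrow>
    L \<le> path_length g + path_length h"
  shows "L \<le> intrinsic_dist S p q + intrinsic_dist S r s"
proof (rule ennreal_le_epsilon)
  fix e :: real assume fin: "intrinsic_dist S p q + intrinsic_dist S r s < top" and "0 < e"
  have near: "\<exists>g. path g \<and> path_image g \<subseteq> S \<and> pathstart g = x \<and> pathfinish g = y \<and>
      path_length g < intrinsic_dist S x y + ennreal (e / 2)" if "intrinsic_dist S x y < top" for x y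
  proof -
    have "intrinsic_dist S x y < intrinsic_dist S x y + ennreal (e / 2)"
      using that \<open>0 < e\<close> by (simp add: ennreal_less_zero_iff)
    then show ?thesis by (subst (asm) intrinsic_dist_def) (auto simp: INF_less_iff)
  qed
  obtain g where g: "path g" "path_image g \<subseteq> S" "pathstart g = p" "pathfinish g = q"
      "path_length g < intrinsic_dist S p q + ennreal (e / 2)"
    using near[of p q] fin by auto
  obtain h where h: "path h" "path_image h \<subseteq> S" "pathstart h = r" "pathfinish h = s"
      "path_length h < intrinsic_dist S r s + ennreal (e / 2)"
    using near[of r s] fin by auto
  have "L \<le> path_length g + path_length h"
    using g h by (intro assms)
  also have "\<dots> \<le> (intrinsic_dist S p q + ennreal (e / 2)) + (intrinsic_dist S r s + ennreal (e / 2))"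
    using g h by (intro add_mono) auto
  also have "\<dots> = intrinsic_dist S p q + intrinsic_dist S r s + (ennreal (e / 2) + ennreal (e / 2))"
    by (simp only: add_ac)
  also have "ennreal (e / 2) + ennreal (e / 2) = ennreal e"
    using \<open>0 < e\<close> by (simp flip: ennreal_plus)
  finally show "L \<le> intrinsic_dist S p q + intrinsic_dist S r s + ennreal e" .
qed

lemma intrinsic_dist_triangle:
  fixes S :: "'a::real_normed_vector set"
  shows "intrinsic_dist S p r \<le> intrinsic_dist S p q + intrinsic_dist S q r"
proof (rule intrinsic_dist_add_greatest)
  fix g h assume g: "path g" "path_image g \<subseteq> S" "pathstart g = p" "pathfinish g = q"
    and h: "path h" "path_image h \<subseteq> S" "pathstart h = q" "pathfinish h = r"
  have "intrinsic_dist S p r \<le> path_length (g +++ h)"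
    using g h by (intro intrinsic_dist_le) (auto simp: path_image_join)
  also have "\<dots> \<le> path_length g + path_length h"
    using g h by (intro path_length_join_le) auto
  finally show "intrinsic_dist S p r \<le> path_length g + path_length h" .
qed

text \<open>Cut the curve at a parameter where it passes through \<open>x\<close>; each piece
  competes in the infimum for its endpoints.\<close>

lemma intrinsic_dist_through_point_le:
  fixes S :: "'a::real_normed_vector set"
  assumes "path g" "path_image g \<subseteq> S" "x \<in> path_image g"
  shows "intrinsic_dist S (pathstart g) x + intrinsic_dist S x (pathfinish g) \<le> path_length g"
proof -
  obtain s where s: "s \<in> {0..1}" "x = g s" using assms(3) by (auto simp: path_image_def)
  have "intrinsic_dist S (pathstart g) x + intrinsic_dist S x (pathfinish g)
      \<le> path_length (subpath 0 s g) + path_length (subpath s 1 g)"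
    using assms s path_image_subpath_subset[of 0 s g] path_image_subpath_subset[of s 1 g]
    by (intro add_mono intrinsic_dist_le path_subpath) (auto simp: pathstart_def pathfinish_def subpath_def)
  also have "\<dots> \<le> path_length g" using s(1) by (rule path_length_subpaths_le)
  finally show ?thesis .
qed

lemma intrinsic_dist_uminus:
  fixes S :: "'a::real_normed_vector set"
  assumes "uminus ` S = S"
  shows "intrinsic_dist S (- p) (- q) = intrinsic_dist S p q"
proof -
  have le: "intrinsic_dist S (- p) (- q) \<le> intrinsic_dist S p q" for p q
  proof (rule intrinsic_dist_greatest)
    fix g assume g: "path g" "path_image g \<subseteq> S" "pathstart g = p" "pathfinish g = q"
    have "path (uminus \<circ> g)"
      using g(1) by (intro path_continuous_image continuous_intros)
    moreover have "path_image (uminus \<circ> g) \<subseteq> S"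
      using g(2) assms by (auto simp: path_image_compose)
    ultimately have "intrinsic_dist S (- p) (- q) \<le> path_length (uminus \<circ> g)"
      using g by (intro intrinsic_dist_le) (auto simp: pathstart_def pathfinish_def)
    also have "\<dots> = path_length g" by (rule path_length_isometry) (simp add: dist_norm norm_minus_commute)
    finally show "intrinsic_dist S (- p) (- q) \<le> path_length g" .
  qed
  from le[of p q] le[of "- p" "- q"] show ?thesis by simp
qed

subsection \<open>Antipodal curves intersect\<close>

text \<open>Stereographic projection of \<open>x / norm x\<close> from \<open>- axis 3 1\<close>; on the ray through that point the
  division by zero gives the junk value \<open>0\<close>.\<close>

definition stereographic :: "real ^ 3 \<Rightarrow> complex" where
  "stereographic x = Complex (x $ 1) (x $ 2) / of_real (norm x + x $ 3)"

lemma power2_norm_vec3: "norm x ^ 2 = (x $ 1)\<^sup>2 + (x $ 2)\<^sup>2 + (x $ 3)\<^sup>2" for x :: "real ^ 3"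
  unfolding power2_norm_eq_inner by (simp add: inner_vec_def sum_3 power2_eq_square)

lemma stereographic_denominator_nonneg: "0 \<le> norm x + x $ 3" for x :: "real ^ 3"
  using component_le_norm_cart[of x 3] by linarith

text \<open>The numerator of the squared modulus factors as a difference of squares. The formula
  recovers the third coordinate from the projection, and it shows that the projection is unbounded
  near the excluded ray.\<close>

lemma norm_stereographic:
  assumes "norm x + x $ 3 \<noteq> 0"
  shows "norm (stereographic x) ^ 2 = (norm x - x $ 3) / (norm x + x $ 3)"
proof -
  have "norm (stereographic x) ^ 2 = ((x $ 1)\<^sup>2 + (x $ 2)\<^sup>2) / (norm x + x $ 3)\<^sup>2"
    by (simp add: stereographic_def norm_divide power_divide cmod_power2)
  also have "(x $ 1)\<^sup>2 + (x $ 2)\<^sup>2 = (norm x - x $ 3) * (norm x + x $ 3)"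
    using power2_norm_vec3[of x] by (simp add: algebra_simps power2_eq_square)
  finally show ?thesis using assms by (simp add: power2_eq_square)
qed

text \<open>The projection determines \<open>x\<close> divided by \<open>norm x + x $ 3\<close>:
  real and imaginary parts give two coordinates, and the modulus gives the third. Hence the ratio of
  the two denominators is the scaling factor.\<close>

lemma stereographic_eq_imp:
  assumes "norm x + x $ 3 \<noteq> 0" "norm y + y $ 3 \<noteq> 0" "stereographic x = stereographic y"
  obtains c where "c > 0" "x = c *\<^sub>R y"
proof
  define m n where "m = norm x + x $ 3" and "n = norm y + y $ 3"
  have mn: "m > 0" "n > 0"
    using assms stereographic_denominator_nonneg[of x] stereographic_denominator_nonneg[of y]
    by (auto simp: m_def n_def)
  then show "m / n > 0" by simp
  have "x $ 1 / m = y $ 1 / n" "x $ 2 / m = y $ 2 / n"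
    using arg_cong[OF assms(3), of Re] arg_cong[OF assms(3), of Im]
    by (auto simp: stereographic_def m_def n_def)
  moreover have "(m - 2 * x $ 3) / m = (n - 2 * y $ 3) / n"
    using norm_stereographic[OF assms(1)] norm_stereographic[OF assms(2)] assms(3)
    by (simp add: m_def n_def)
  then have "x $ 3 / m = y $ 3 / n"
    using mn by (simp add: diff_divide_distrib)
  ultimately show "x = (m / n) *\<^sub>R y"
    using mn by (simp add: vec_eq_iff forall_3 field_simps)
qed

text \<open>In the plane the antipodal map becomes \<open>z\<close> to \<open>-1 / cnj z\<close>,
  which is a negative real multiple of \<open>z\<close>. Only this reversal of direction enters the
  winding argument.\<close>

lemma stereographic_uminus:
  assumes "norm x + x $ 3 \<noteq> 0" "norm x - x $ 3 \<noteq> 0"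
  obtains r where "r > 0" "stereographic (- x) = - of_real r * stereographic x"
proof
  show "(norm x + x $ 3) / (norm x - x $ 3) > 0"
    using assms stereographic_denominator_nonneg[of x] stereographic_denominator_nonneg[of "- x"]
    by simp
  show "stereographic (- x) = - of_real ((norm x + x $ 3) / (norm x - x $ 3)) * stereographic x"
    using assms by (simp add: stereographic_def complex_eq_iff)
qed

lemma continuous_on_stereographic:
  assumes "continuous_on A f" "\<And>t. t \<in> A \<Longrightarrow> norm (f t) + f t $ 3 \<noteq> 0"
  shows "continuous_on A (\<lambda>t. stereographic (f t))"
proof -
  have "of_real (norm (f t) + f t $ 3) \<noteq> (0::complex)" if "t \<in> A" for t
    using assms(2)[OF that] by (metis of_real_eq_0_iff)
  then show ?thesis
    unfolding stereographic_def Complex_eq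
    by (intro continuous_intros assms(1)) auto
qed

lemma stereographic_denominator_eq_0:
  fixes x :: "real ^ 3"
  assumes "norm x + x $ 3 = 0"
  shows "x = (x $ 3) *\<^sub>R axis 3 1" "x $ 3 \<le> 0"
proof -
  have "norm x = - (x $ 3)" using assms by simp
  then have "(x $ 1)\<^sup>2 + (x $ 2)\<^sup>2 = 0" using power2_norm_vec3[of x] by simp
  then show "x = (x $ 3) *\<^sub>R axis 3 1" by (simp add: vec_eq_iff forall_3 axis_def sum_power2_eq_zero_iff)
  show "x $ 3 \<le> 0" using assms norm_ge_zero[of x] by linarith
qed

text \<open>Both halves of the loop change the imaginary part of \<open>l\<close> by the same odd multiple of \<open>\<pi>\<close>.\<close>

lemma no_closed_log_of_antipodal_loop:
  fixes l :: "real \<Rightarrow> complex"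
  assumes "continuous_on {0..1} l" "l 1 = l 0"
    and "\<And>t. t \<in> {0..1/2} \<Longrightarrow> \<exists>r>0. exp (l (t + 1/2)) = - of_real r * exp (l t)"
  shows False
proof -
  define h where "h t = Im (l (t + 1/2) - l t)" for t
  have cont: "continuous_on {0..1/2} h"
    unfolding h_def
    by (intro continuous_intros continuous_on_compose2[OF assms(1)]) auto
  \<comment> \<open>The two half-turns add up to the total change of \<open>l\<close>, which is
    zero, so \<open>h\<close> has a zero. There \<open>exp\<close> of the difference is a positive
    real, whereas the hypothesis makes it negative.\<close>
  have opp: "h (1/2) = - h 0" using assms(2) by (simp add: h_def)
  have "\<exists>t\<in>{0..1/2}. h t = 0"
  proof (cases "h 0 \<le> 0")
    case True
    then show ?thesis using IVT'[of h 0 0 "1/2"] cont opp by auto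
  next
    case False
    then show ?thesis using IVT2'[of h "1/2" 0 0] cont opp by auto
  qed
  then obtain t where t: "t \<in> {0..1/2}" "h t = 0" by blast
  obtain r where r: "r > 0" "exp (l (t + 1/2)) = - of_real r * exp (l t)" using assms(3)[OF t(1)] by blast
  have "exp (l (t + 1/2) - l t) = - of_real r" using r(2) by (simp add: exp_diff)
  moreover have "Re (exp (l (t + 1/2) - l t)) = exp (Re (l (t + 1/2) - l t))"
    using t(2) unfolding h_def by (simp add: Re_exp)
  ultimately have "exp (Re (l (t + 1/2) - l t)) = - r" by simp
  then show False using r(1) exp_gt_zero[of "Re (l (t + 1/2) - l t)"] by linarith
qed

text \<open>Up to the first time it reaches the ray of projection, \<open>\<alpha>\<close> is projected to a connected unbounded
  set that contains \<open>0\<close>. If it avoids the projection of the loop formed by \<open>\<beta>\<close> and \<open>-\<beta>\<close>, that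
  loop has winding number \<open>0\<close> about \<open>0\<close>, hence a closed logarithm.\<close>

lemma antipodal_paths_cross_from_axis:
  fixes \<alpha> \<beta> :: "real \<Rightarrow> real ^ 3"
  assumes \<alpha>: "path \<alpha>" "0 \<notin> path_image \<alpha>" "pathstart \<alpha> = k *\<^sub>R axis 3 1" "k > 0"
      "pathfinish \<alpha> = - pathstart \<alpha>"
    and \<beta>: "path \<beta>" "0 \<notin> path_image \<beta>" "pathfinish \<beta> = - pathstart \<beta>"
    and disj: "\<And>x y c. x \<in> path_image \<alpha> \<Longrightarrow> y \<in> path_image \<beta> \<Longrightarrow> c \<noteq> 0 \<Longrightarrow> x \<noteq> c *\<^sub>R y"
  shows False
proof -
  define \<gamma> where "\<gamma> = \<beta> +++ (\<lambda>t. - \<beta> t)"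
  have "path (\<lambda>t. - \<beta> t)" using \<beta>(1) unfolding path_def by (intro continuous_intros)
  then have \<gamma>: "path \<gamma>"
    using \<beta> unfolding \<gamma>_def by (simp add: pathstart_def pathfinish_def)
  have \<gamma>_image: "\<gamma> t \<in> path_image \<beta> \<or> - \<gamma> t \<in> path_image \<beta>" if "t \<in> {0..1}" for t
    using that by (auto simp: \<gamma>_def joinpaths_def path_image_def)
  have \<alpha>\<gamma>: "x \<noteq> c *\<^sub>R \<gamma> t" if "t \<in> {0..1}" "x \<in> path_image \<alpha>" for t c x
  proof (cases "c = 0")
    case True
    then show ?thesis using that \<alpha>(2) by auto
  next
    case False
    then show ?thesis
      using \<gamma>_image[OF that(1)] disj[OF that(2) _ False] disj[OF that(2), of "- \<gamma> t" "- c"] by auto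
  qed
  \<comment> \<open>As \<open>\<alpha>\<close> starts on the axis, any nonzero axis point is a
    multiple of its start. So the loop avoids both the ray of projection and its opposite:
    \<open>G\<close> is continuous, and \<open>stereographic_uminus\<close> applies along
    it.\<close>
  have \<gamma>_axis: "\<gamma> t \<noteq> d *\<^sub>R axis 3 1" if "t \<in> {0..1}" for t d
  proof
    assume eq: "\<gamma> t = d *\<^sub>R axis 3 1"
    then have "d \<noteq> 0" using \<gamma>_image[OF that] \<beta>(2) by auto
    then have "pathstart \<alpha> = (k / d) *\<^sub>R \<gamma> t" by (simp add: eq \<alpha>(3))
    then show False using \<alpha>\<gamma>[OF that pathstart_in_path_image] by blast
  qed
  have \<gamma>_pos: "norm (\<gamma> t) + \<gamma> t $ 3 \<noteq> 0" "norm (\<gamma> t) - \<gamma> t $ 3 \<noteq> 0" if "t \<in> {0..1}" for t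
  proof -
    show "norm (\<gamma> t) + \<gamma> t $ 3 \<noteq> 0"
      using stereographic_denominator_eq_0(1) \<gamma>_axis[OF that] by blast
    show "norm (\<gamma> t) - \<gamma> t $ 3 \<noteq> 0"
      using stereographic_denominator_eq_0(1)[of "- \<gamma> t"] \<gamma>_axis[OF that, of "\<gamma> t $ 3"] by auto
  qed
  define G where "G t = stereographic (\<gamma> t)" for t
  have G: "path G"
    using \<gamma> \<gamma>_pos(1) unfolding G_def path_def by (intro continuous_on_stereographic)
  have G_loop: "pathfinish G = pathstart G"
    using \<beta>(3) by (simp add: G_def \<gamma>_def pathstart_def pathfinish_def joinpaths_def)

  define A where "A t = norm (\<alpha> t) + \<alpha> t $ 3" for t
  have cont_\<alpha>: "continuous_on {0..1} \<alpha>" using \<alpha>(1) by (simp add: path_def)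
  then have cont_A: "continuous_on {0..1} A"
    unfolding A_def by (intro continuous_intros)
  have A0: "A 0 > 0" and A1: "A 1 = 0"
    using \<alpha>(3-5) by (simp_all add: A_def pathstart_def pathfinish_def)
  let ?Z = "{t \<in> {0..1}. A t = 0}"
  have "closed ?Z" using continuous_closed_preimage_constant[OF cont_A] by simp
  then have "compact ?Z" by (simp add: compact_eq_bounded_closed bounded_subset[of "{0..1}"] subset_eq)
  moreover have "?Z \<noteq> {}" using A1 by auto
  ultimately obtain T where T: "T \<in> ?Z" "\<And>t. t \<in> ?Z \<Longrightarrow> T \<le> t"
    using compact_attains_inf[of ?Z] by blast
  have T01: "0 < T" "T \<le> 1" using T(1) A0 by (auto simp: order_less_le)
  have A_nz: "A t \<noteq> 0" if "t \<in> {0..<T}" for t using T(2)[of t] that T01 by fastforce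
  define K where "K = (\<lambda>t. stereographic (\<alpha> t)) ` {0..<T}"
  have "continuous_on {0..<T} (\<lambda>t. stereographic (\<alpha> t))"
    using A_nz T01 unfolding A_def
    by (intro continuous_on_stereographic continuous_on_subset[OF cont_\<alpha>]) auto
  then have "connected K" unfolding K_def by (rule connected_continuous_image) simp
  have "0 \<in> K"
  proof -
    have "stereographic (\<alpha> 0) = 0"
      using \<alpha>(3) by (simp add: stereographic_def pathstart_def axis_def complex_eq_iff)
    then show ?thesis using T01 unfolding K_def by force
  qed
  have "K \<subseteq> - path_image G"
  proof (rule ccontr)
    assume "\<not> K \<subseteq> - path_image G"
    then obtain z where "z \<in> K" "z \<in> path_image G" by blast
    then obtain s t where st: "s \<in> {0..<T}" "t \<in> {0..1}" "stereographic (\<alpha> s) = stereographic (\<gamma> t)"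
      unfolding K_def G_def path_image_def by (elim imageE) simp
    obtain c where "\<alpha> s = c *\<^sub>R \<gamma> t"
      using stereographic_eq_imp[OF _ _ st(3)] A_nz[OF st(1)] \<gamma>_pos(1)[OF st(2)] by (auto simp: A_def)
    moreover have "\<alpha> s \<in> path_image \<alpha>" using st(1) T01 by (auto simp: path_image_def)
    ultimately show False using \<alpha>\<gamma>[OF st(2)] by blast
  qed
  have "\<not> bounded K"
  proof
    assume "bounded K"
    then obtain B where B: "B > 0" "\<And>z. z \<in> K \<Longrightarrow> norm z \<le> B" by (auto simp: bounded_pos)
    \<comment> \<open>\<open>?D t \<le> 0\<close> is the bound \<open>B\<close> on the modulus with
      denominators cleared. In this form it survives the limit at \<open>T\<close>, where
      \<open>A T = 0\<close> then forces \<open>\<alpha> T = 0\<close>.\<close>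
    let ?D = "\<lambda>t. (norm (\<alpha> t) - \<alpha> t $ 3) - B\<^sup>2 * A t"
    have "?D t \<le> 0" if "t \<in> {0..<T}" for t
    proof -
      have "A t > 0" using A_nz[OF that] stereographic_denominator_nonneg[of "\<alpha> t"] by (simp add: A_def)
      moreover have "norm (stereographic (\<alpha> t)) ^ 2 \<le> B\<^sup>2"
        using that by (intro power_mono B(2)) (auto simp: K_def)
      ultimately show ?thesis
        using norm_stereographic[of "\<alpha> t"] by (simp add: A_def divide_le_eq)
    qed
    moreover have "continuous_on (closure {0..<T}) ?D"
      using T01 unfolding A_def
      by (intro continuous_intros continuous_on_subset[OF cont_\<alpha>]) auto
    moreover have "T \<in> closure {0..<T}" using T01 by simp
    ultimately have "?D T \<le> 0" by (rule continuous_le_on_closure[rotated 2])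
    then have le: "norm (\<alpha> T) - \<alpha> T $ 3 \<le> 0" "norm (\<alpha> T) + \<alpha> T $ 3 = 0"
      using T(1) by (simp_all add: A_def)
    then have "norm (\<alpha> T) \<le> 0" by linarith
    moreover have "\<alpha> T \<in> path_image \<alpha>" using T01 by (auto simp: path_image_def)
    ultimately show False using \<alpha>(2) by simp
  qed
  have "K \<subseteq> connected_component_set (- path_image G) 0"
    using \<open>0 \<in> K\<close> \<open>connected K\<close> \<open>K \<subseteq> - path_image G\<close> by (rule connected_component_maximal)
  then have out: "0 \<in> outside (path_image G)"
    using \<open>\<not> bounded K\<close> bounded_subset by (auto simp: outside)
  then have "winding_number G 0 = 0" using G G_loop by (intro winding_number_zero_in_outside)
  moreover have "0 \<notin> path_image G" using out by (auto simp: outside_def)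
  ultimately obtain l where l: "path l" "pathfinish l = pathstart l"
      "\<And>t. t \<in> {0..1} \<Longrightarrow> G t = exp (l t)"
    using winding_number_as_continuous_log[OF G, of 0] by auto
  show False
  proof (rule no_closed_log_of_antipodal_loop)
    show "continuous_on {0..1} l" "l 1 = l 0"
      using l by (auto simp: path_def pathstart_def pathfinish_def)
    fix t :: real assume t: "t \<in> {0..1/2}"
    \<comment> \<open>At \<open>t = 0\<close> both sides lie on the first branch of the join, and
      the equation is the antipodality of the ends of \<open>\<beta>\<close>.\<close>
    have "\<gamma> (t + 1/2) = - \<gamma> t"
      using t \<beta>(3) by (auto simp: \<gamma>_def joinpaths_def pathstart_def pathfinish_def)
    moreover obtain r where "r > 0" "stereographic (- \<gamma> t) = - of_real r * stereographic (\<gamma> t)"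
      using stereographic_uminus[of "\<gamma> t"] \<gamma>_pos[of t] t by auto
    ultimately show "\<exists>r>0. exp (l (t + 1/2)) = - of_real r * exp (l t)"
      using t l(3)[of t] l(3)[of "t + 1/2"] by (auto simp: G_def)
  qed
qed

text \<open>An orthogonal map moves the start of \<open>\<alpha>\<close> to the positive third axis
  and preserves scalar multiples, which reduces the claim to the previous lemma. The conclusion says
  that \<open>x\<close> and \<open>y\<close> represent the same point of the projective
  plane.\<close>

lemma antipodal_paths_cross:
  fixes \<alpha> \<beta> :: "real \<Rightarrow> real ^ 3"
  assumes \<alpha>: "path \<alpha>" "0 \<notin> path_image \<alpha>" "pathfinish \<alpha> = - pathstart \<alpha>"
    and \<beta>: "path \<beta>" "0 \<notin> path_image \<beta>" "pathfinish \<beta> = - pathstart \<beta>"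
  obtains x y c where "x \<in> path_image \<alpha>" "y \<in> path_image \<beta>" "c \<noteq> 0" "x = c *\<^sub>R y"
proof (rule ccontr)
  assume "\<not> thesis"
  with that have disj: "x \<noteq> c *\<^sub>R y"
    if "x \<in> path_image \<alpha>" "y \<in> path_image \<beta>" "c \<noteq> 0" for x y c using that by blast
  define k where "k = norm (pathstart \<alpha>)"
  have "pathstart \<alpha> \<noteq> 0" using \<alpha>(2) pathstart_in_path_image[of \<alpha>] by metis
  then have k: "k > 0" by (simp add: k_def)
  have "norm (pathstart \<alpha>) = norm (k *\<^sub>R axis 3 1 :: real ^ 3)" by (simp add: k_def)
  then obtain f :: "real ^ 3 \<Rightarrow> real ^ 3" where
    f: "orthogonal_transformation f" "f (pathstart \<alpha>) = k *\<^sub>R axis 3 1"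
    by (rule orthogonal_transformation_exists)
  have lin: "linear f" and inj: "inj f" using f(1)
    by (auto intro: orthogonal_transformation_linear orthogonal_transformation_inj)
  have f0: "0 = f x \<longleftrightarrow> x = 0" for x
    using orthogonal_transformation_norm[OF f(1), of x] by (metis norm_eq_zero)
  have cont: "continuous_on X f" for X using lin by (simp add: linear_continuous_on linear_linear)
  show False
  proof (rule antipodal_paths_cross_from_axis[of "f \<circ> \<alpha>" k "f \<circ> \<beta>"])
    show "path (f \<circ> \<alpha>)" "path (f \<circ> \<beta>)"
      using \<alpha>(1) \<beta>(1) by (auto intro: path_continuous_image cont)
    show "0 \<notin> path_image (f \<circ> \<alpha>)" "0 \<notin> path_image (f \<circ> \<beta>)"
      using \<alpha>(2) \<beta>(2) by (auto simp: path_image_compose image_iff f0)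
    show "pathstart (f \<circ> \<alpha>) = k *\<^sub>R axis 3 1" "k > 0" using f(2) k by (auto simp: pathstart_compose)
    show "pathfinish (f \<circ> \<alpha>) = - pathstart (f \<circ> \<alpha>)" "pathfinish (f \<circ> \<beta>) = - pathstart (f \<circ> \<beta>)"
      using \<alpha>(3) \<beta>(3) lin by (auto simp: pathstart_compose pathfinish_compose linear_neg)
    fix x y c assume "x \<in> path_image (f \<circ> \<alpha>)" "y \<in> path_image (f \<circ> \<beta>)" and c: "c \<noteq> (0::real)"
    then obtain u v where uv: "u \<in> path_image \<alpha>" "v \<in> path_image \<beta>" "x = f u" "y = f v"
      by (auto simp: path_image_compose)
    have "f u \<noteq> f (c *\<^sub>R v)" using disj[OF uv(1,2) c] inj by (auto dest: injD)
    then show "x \<noteq> c *\<^sub>R y" using uv lin by (simp add: linear_cmul)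
  qed
qed

subsection \<open>The boundary of a convex body\<close>

text \<open>Take an inward normal \<open>a\<close> of a supporting hyperplane at \<open>p\<close>
  and step outwards to \<open>p - a\<close>. If the interior is empty, a hyperplane containing
  \<open>P\<close> serves.\<close>

lemma exists_point_outside_with_closest_point:
  fixes P :: "'a::euclidean_space set"
  assumes "convex P" "closed P" and p: "p \<in> frontier P"
  obtains u where "u \<notin> P" "closest_point P u = p"
proof -
  have pP: "p \<in> P" using p assms(2) frontier_subset_closed by blast
  have "\<exists>a. a \<noteq> 0 \<and> (\<forall>x\<in>P. a \<bullet> p \<le> a \<bullet> x)"
  proof (cases "interior P = {}")
    case True
    then obtain a b where ab: "a \<noteq> 0" "P \<subseteq> {x. a \<bullet> x = b}"
      using empty_interior_subset_hyperplane[OF assms(1)] by blast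
    then have "a \<bullet> p \<le> a \<bullet> x" if "x \<in> P" for x using pP that by (metis (mono_tags) mem_Collect_eq order_refl subsetD)
    with ab show ?thesis by blast
  next
    case False
    then have "rel_interior P = interior P" by (rule rel_interior_nonempty_interior)
    moreover have "p \<notin> interior P" using p by (simp add: frontier_def)
    ultimately show ?thesis
      using supporting_hyperplane_rel_boundary[OF assms(1) pP] by metis
  qed
  then obtain a where a: "a \<noteq> 0" "\<And>x. x \<in> P \<Longrightarrow> a \<bullet> p \<le> a \<bullet> x" by blast
  show thesis
  proof
    show "p - a \<notin> P"
    proof
      assume "p - a \<in> P"
      from a(2)[OF this] have "a \<bullet> a \<le> 0" by (simp add: inner_diff_right)
      then show False using a(1) by (simp add: inner_gt_zero_iff flip: not_less)
    qed
    have "dist (p - a) p \<le> dist (p - a) x" if "x \<in> P" for x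
    proof -
      have "(norm (p - a - x))\<^sup>2 = (norm a)\<^sup>2 + (norm (x - p))\<^sup>2 + 2 * (a \<bullet> x - a \<bullet> p)"
        by (simp add: power2_norm_eq_inner inner_diff inner_commute algebra_simps)
      also have "\<dots> \<ge> (norm a)\<^sup>2" using a(2)[OF that] by simp
      finally have "norm a \<le> norm (p - a - x)" by (rule power2_le_imp_le) simp
      then show ?thesis by (simp add: dist_norm)
    qed
    then show "closest_point P (p - a) = p"
      using closest_point_unique[OF assms(1,2) pP] by metis
  qed
qed

lemma closest_point_in_frontier:
  fixes P :: "'a::euclidean_space set"
  assumes "closed P" "P \<noteq> {}" "u \<notin> P"
  shows "closest_point P u \<in> frontier P"
proof -
  have c: "closest_point P u \<in> P" by (rule closest_point_in_set[OF assms(1,2)])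
  have "closest_point P u \<notin> interior P"
  proof
    assume i: "closest_point P u \<in> interior P"
    have "closest_point P u \<in> rel_interior P" using i interior_subset_rel_interior by blast
    \<comment> \<open>An interior point makes the affine hull the whole space, so
      \<open>closest_point_in_rel_interior\<close> applies to \<open>u\<close> and would put
      \<open>u\<close> itself in \<open>P\<close>.\<close>
    moreover have "affine hull P = UNIV" using i affine_hull_nonempty_interior by blast
    ultimately have "u \<in> rel_interior P" using closest_point_in_rel_interior[OF assms(1,2), of u] by simp
    then show False using assms(3) rel_interior_subset by blast
  qed
  then show ?thesis using c closure_subset by (auto simp: frontier_def)
qed

lemma polynomial_function_lipschitz_on_interval:
  fixes g :: "real \<Rightarrow> 'a::euclidean_space"
  assumes "polynomial_function g"
  obtains C where "C-lipschitz_on {a..b} g"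
proof -
  obtain g' where g': "polynomial_function g'" "\<And>x. (g has_vector_derivative g' x) (at x)"
    using has_vector_derivative_polynomial_function[OF assms] by blast
  have "compact (g' ` {a..b})"
    using g'(1) by (intro compact_continuous_image continuous_on_polymonial_function) auto
  then obtain C where C: "C > 0" "\<And>x. x \<in> {a..b} \<Longrightarrow> norm (g' x) \<le> C"
    using compact_imp_bounded bounded_pos by (metis image_eqI)
  have "C-lipschitz_on {a..b} g"
  proof (rule bounded_derivative_imp_lipschitz)
    fix x assume x: "x \<in> {a..b}"
    show "(g has_derivative (\<lambda>h. h *\<^sub>R g' x)) (at x within {a..b})"
      using g'(2) unfolding has_vector_derivative_def by (rule has_derivative_at_withinI)
    show "onorm (\<lambda>h. h *\<^sub>R g' x) \<le> C"
      using C(2)[OF x] by (intro onorm_le) (simp add: mult.commute[of C] mult_left_mono)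
  qed (use C in auto)
  then show thesis by (rule that)
qed

text \<open>Both points are images under the nearest-point retraction onto \<open>P\<close>, which does not
  increase lengths, of points outside \<open>P\<close>; these are joined by a polynomial path avoiding \<open>P\<close>.\<close>

lemma intrinsic_dist_frontier_finite:
  fixes P :: "'a::euclidean_space set"
  assumes P: "convex P" "compact P" "2 \<le> DIM('a)" and p: "p \<in> frontier P" and q: "q \<in> frontier P"
  shows "intrinsic_dist (frontier P) p q < top"
proof -
  have cl: "closed P" using P(2) by (rule compact_imp_closed)
  obtain u where u: "u \<notin> P" "closest_point P u = p"
    using exists_point_outside_with_closest_point[OF P(1) cl p] .
  obtain v where v: "v \<notin> P" "closest_point P v = q"
    using exists_point_outside_with_closest_point[OF P(1) cl q] .
  have ne: "P \<noteq> {}" using p by auto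
  have "connected (- P)" using P by (intro connected_complement_bounded_convex compact_imp_bounded)
  \<comment> \<open>A continuous path might have infinite length; a polynomial one is Lipschitz on
    the unit interval.\<close>
  then obtain g where g: "polynomial_function g" "path_image g \<subseteq> - P" "pathstart g = u" "pathfinish g = v"
    using connected_open_polynomial_connected[of "- P" u v] u v cl by (auto simp: open_Compl)
  obtain C where C: "C-lipschitz_on {0..1} g"
    using polynomial_function_lipschitz_on_interval[OF g(1)] .
  let ?h = "closest_point P \<circ> g"
  have h: "C-lipschitz_on {0..1} ?h"
  proof (rule lipschitz_onI)
    show "0 \<le> C" using C lipschitz_on_nonneg by blast
    fix x y :: real assume "x \<in> {0..1}" "y \<in> {0..1}"
    then show "dist (?h x) (?h y) \<le> C * dist x y"
      using closest_point_lipschitz[OF P(1) cl ne, of "g x" "g y"] lipschitz_onD[OF C, of x y] by simp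
  qed
  have "intrinsic_dist (frontier P) p q \<le> path_length ?h"
  proof (rule intrinsic_dist_le)
    show "path ?h" unfolding path_def using h by (rule lipschitz_on_continuous_on)
    show "path_image ?h \<subseteq> frontier P"
      using g(2) closest_point_in_frontier[OF cl ne] by (auto simp: path_image_compose)
    show "pathstart ?h = p" "pathfinish ?h = q"
      using g u v by (auto simp: pathstart_compose pathfinish_compose)
  qed
  also have "\<dots> \<le> ennreal C" using h by (rule path_length_lipschitz_le)
  also have "\<dots> < top" by simp
  finally show ?thesis .
qed

text \<open>Of two distinct boundary points on a ray from \<open>0\<close>, the nearer lies in an
  open segment from an interior point to a point of the closure, hence in the interior. The case
  \<open>c > 1\<close> follows by exchanging the points.\<close>

lemma frontier_ray_unique:
  fixes P :: "'a::euclidean_space set"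
  assumes "convex P" "closed P" "0 \<in> interior P"
    and x: "x \<in> frontier P" "c *\<^sub>R x \<in> frontier P" and "c > 0"
  shows "c = 1"
proof -
  have less: False if y: "y \<in> frontier P" "d *\<^sub>R y \<in> frontier P" "0 < d" "d < 1" for y d
  proof -
    have "y \<noteq> 0" using y(1) assms(3) by (auto simp: frontier_def)
    then have "d *\<^sub>R y \<in> open_segment 0 y"
      using y by (auto simp: in_segment intro!: exI[of _ d])
    moreover have "y \<in> closure P" using y(1) by (simp add: frontier_def)
    ultimately have "d *\<^sub>R y \<in> interior P"
      using in_interior_closure_convex_segment[OF assms(1,3)] by blast
    with y(2) show False by (simp add: frontier_def)
  qed
  show ?thesis
    using less[OF x] less[of "c *\<^sub>R x" "1 / c"] x \<open>c > 0\<close> by (cases c "1::real" rule: linorder_cases) auto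
qed

lemma zero_in_interior_symmetric:
  fixes P :: "'a::euclidean_space set"
  assumes "convex P" "uminus ` P = P" "interior P \<noteq> {}"
  shows "0 \<in> interior P"
proof -
  obtain z where z: "z \<in> interior P" using assms(3) by blast
  then have "- z \<in> interior P" using interior_negations[of P] assms(2) by (metis imageI)
  then have "(1/2) *\<^sub>R z + (1/2) *\<^sub>R (- z) \<in> interior P"
    using z convex_interior[OF assms(1)] by (intro convexD) auto
  then show ?thesis by simp
qed

lemma frontier_symmetric:
  fixes P :: "'a::euclidean_space set"
  assumes "uminus ` P = P"
  shows "uminus ` frontier P = frontier P"
proof -
  have "uminus ` frontier P = uminus ` closure P - uminus ` interior P"
    unfolding frontier_def by (rule image_set_diff) simp
  then show ?thesis
    using closure_injective_linear_image[OF linear_uminus inj_uminus, of P]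
      interior_injective_linear_image[OF linear_uminus inj_uminus, of P] assms
    by (simp add: frontier_def)
qed

subsection \<open>Orbits of the farthest point map\<close>

text \<open>The definition splits off the last step of an orbit; the main argument has to split off
  the first.\<close>

lemma set_iterate_Suc_first: "set_iterate f (Suc n) p = (\<Union>q \<in> f p. set_iterate f n q)"
  by (induction n) auto

lemma farthest_antipodal_iff:
  "q \<in> farthest_antipodal S p \<longleftrightarrow> q \<in> S \<and> (\<forall>r\<in>S. intrinsic_dist S (- p) r \<le> intrinsic_dist S (- p) q)"
  by (auto simp: farthest_antipodal_def farthest_points_def antipodal_map_def)

text \<open>By this symmetry, the predecessor of an orbit point competes in the maximisation that
  defines its successor.\<close>

lemma intrinsic_dist_uminus_commute:
  fixes S :: "'a::real_normed_vector set"
  assumes "uminus ` S = S"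
  shows "intrinsic_dist S (- p) q = intrinsic_dist S (- q) p"
  using intrinsic_dist_uminus[OF assms, of p "- q"] by (simp add: intrinsic_dist_commute)

lemma farthest_dist_mono_along_orbit:
  fixes S :: "'a::real_normed_vector set"
  assumes S: "uminus ` S = S" and "p \<in> S" and q: "q \<in> farthest_antipodal S p"
    and "r \<in> set_iterate (farthest_antipodal S) n q" and "s \<in> farthest_antipodal S r"
  shows "intrinsic_dist S (- p) q \<le> intrinsic_dist S (- r) s"
  using assms(4,5)
proof (induction n arbitrary: r s)
  case 0
  have "intrinsic_dist S (- p) q = intrinsic_dist S (- q) p"
    using S by (rule intrinsic_dist_uminus_commute)
  also have "\<dots> \<le> intrinsic_dist S (- q) s"
    using 0 \<open>p \<in> S\<close> by (auto simp: farthest_antipodal_iff)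
  finally show ?case using 0 by simp
next
  case (Suc n)
  then obtain t where t: "t \<in> set_iterate (farthest_antipodal S) n q" "r \<in> farthest_antipodal S t"
    by auto
  have "t \<in> S" using t(1) q by (cases n) (auto simp: farthest_antipodal_iff)
  have "intrinsic_dist S (- p) q \<le> intrinsic_dist S (- t) r" using t by (rule Suc.IH)
  also have "\<dots> = intrinsic_dist S (- r) t" using S by (rule intrinsic_dist_uminus_commute)
  also have "\<dots> \<le> intrinsic_dist S (- r) s"
    using Suc.prems(2) \<open>t \<in> S\<close> by (auto simp: farthest_antipodal_iff)
  finally show ?case .
qed

text \<open>At the crossing point of curves from \<open>-p\<close> to \<open>p\<close> and from \<open>-q\<close> to \<open>q\<close> one can switch
  from one curve to the other.\<close>

lemma intrinsic_dist_antipodal_crossing: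
  fixes P :: "(real ^ 3) set"
  assumes P: "convex P" "closed P" "interior P \<noteq> {}" "uminus ` P = P"
  defines "d \<equiv> intrinsic_dist (frontier P)"
  shows "d (- p) q + d (- p) q \<le> d (- p) p + d (- q) q"
  unfolding d_def
proof (rule intrinsic_dist_add_greatest)
  let ?S = "frontier P"
  have S: "uminus ` ?S = ?S" using P(4) by (rule frontier_symmetric)
  have int0: "0 \<in> interior P" using P(1,4,3) by (rule zero_in_interior_symmetric)
  have neg: "- y \<in> ?S" if "y \<in> ?S" for y using S that by blast
  have d: "d (- x) (- y) = d x y" "d x y = d y x" "d (- x) y = d (- y) x" "d x (- y) = d y (- x)" for x y
    using intrinsic_dist_uminus[OF S, of x y] intrinsic_dist_uminus_commute[OF S, of x y]
    by (simp_all add: d_def intrinsic_dist_commute)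
  fix \<alpha> \<beta> assume \<alpha>: "path \<alpha>" "path_image \<alpha> \<subseteq> ?S" "pathstart \<alpha> = - p" "pathfinish \<alpha> = p"
    and \<beta>: "path \<beta>" "path_image \<beta> \<subseteq> ?S" "pathstart \<beta> = - q" "pathfinish \<beta> = q"
  have "0 \<notin> ?S" using int0 by (simp add: frontier_def)
  then obtain x y c where x: "x \<in> path_image \<alpha>" and y: "y \<in> path_image \<beta>" and c: "c \<noteq> 0" "x = c *\<^sub>R y"
    using antipodal_paths_cross[OF \<alpha>(1) _ _ \<beta>(1)] \<alpha> \<beta> by (metis minus_minus subsetD)
  have xS: "x \<in> ?S" "y \<in> ?S" using x y \<alpha> \<beta> by auto
  have "x = y \<or> x = - y"
  proof (cases "c > 0")
    case True
    then have "c = 1" using frontier_ray_unique[OF P(1,2) int0, of y c] xS c by simp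
    then show ?thesis using c by simp
  next
    case False
    then have "- c = 1" using frontier_ray_unique[OF P(1,2) int0, of "- y" "- c"] xS neg c by simp
    then have "c = - 1" by simp
    then show ?thesis using c by simp
  qed
  \<comment> \<open>If \<open>x = - y\<close>, negating both segments exchanges the two summands, so
    the total through \<open>x\<close> is the same as through \<open>y\<close>.\<close>
  then have "d (- q) x + d x q = d (- q) y + d y q"
    using d(1)[of q y] d(2)[of q y] d(2)[of "- y" q] d(3)[of y q] d(2)[of "- q" y]
    by (auto simp: add.commute)
  then have \<beta>_ge: "d (- q) x + d x q \<le> path_length \<beta>"
    using intrinsic_dist_through_point_le[OF \<beta>(1,2) y] \<beta>(3,4) by (simp add: d_def)
  have \<alpha>_ge: "d (- p) x + d x p \<le> path_length \<alpha>"
    using intrinsic_dist_through_point_le[OF \<alpha>(1,2) x] \<alpha>(3,4) by (simp add: d_def)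
  have "d (- p) q + d (- p) q = d (- p) q + d (- q) p" using d(3)[of p q] by simp
  \<comment> \<open>The exchange at \<open>x\<close>: both curves are followed to \<open>x\<close>,
    and each continues on the end of the other.\<close>
  also have "\<dots> \<le> (d (- p) x + d x q) + (d (- q) x + d x p)"
    unfolding d_def by (intro add_mono intrinsic_dist_triangle)
  also have "\<dots> = (d (- p) x + d x p) + (d (- q) x + d x q)" by (simp only: add_ac)
  also have "\<dots> \<le> path_length \<alpha> + path_length \<beta>" using \<alpha>_ge \<beta>_ge by (rule add_mono)
  finally show "intrinsic_dist ?S (- p) q + intrinsic_dist ?S (- p) q \<le> path_length \<alpha> + path_length \<beta>"
    by (simp add: d_def)
qed

theorem theorem1p1:
  fixes P \<Sigma> :: "(real ^ 3) set"
  assumes "polytope P" and "interior P \<noteq> {}"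
    and "antipodal_map ` P = P"
    and "\<Sigma> = frontier P"
  shows "\<not> (\<exists>p\<in>\<Sigma>. \<exists>n. generalized_periodic_point (farthest_antipodal \<Sigma>) n p)"
proof
  let ?f = "farthest_antipodal \<Sigma>" and ?d = "intrinsic_dist \<Sigma>"
  assume "\<exists>p\<in>\<Sigma>. \<exists>n. generalized_periodic_point ?f n p"
  then obtain p n where p: "p \<in> \<Sigma>" "n > 1" "p \<in> set_iterate ?f n p" and not_fixed: "p \<notin> set_iterate ?f 1 p"
    unfolding generalized_periodic_point_def by (metis order_refl)
  have P: "convex P" "compact P" "closed P"
    using assms(1) by (auto intro: polytope_imp_convex polytope_imp_compact polytope_imp_closed)
  have sym: "uminus ` P = P" using assms(3) by (simp add: antipodal_map_def[abs_def])
  have S: "uminus ` \<Sigma> = \<Sigma>" unfolding assms(4) using sym by (rule frontier_symmetric)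
  \<comment> \<open>Two steps are split off, \<open>p\<close> to \<open>q\<close> to
    \<open>r\<close>; for \<open>n = 2\<close> the remaining orbit is trivial and
    \<open>r = p\<close>.\<close>
  obtain k where k: "n = Suc (Suc k)"
    by (rule that[of "n - 2"]) (use p(2) in linarith)
  obtain q r where q: "q \<in> ?f p" and r: "r \<in> ?f q" and orbit: "p \<in> set_iterate ?f k r"
    using p(3) unfolding k set_iterate_Suc_first by blast
  have "q \<in> \<Sigma>" using q by (simp add: farthest_antipodal_iff)
  have "?d (- q) q \<le> ?d (- q) r" using r \<open>q \<in> \<Sigma>\<close> by (simp add: farthest_antipodal_iff)
  also have "\<dots> \<le> ?d (- p) q"
    \<comment> \<open>Monotonicity is applied once around the cycle: from the step \<open>q\<close>
      to \<open>r\<close>, along the orbit to \<open>p\<close>, and ending with the step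
      \<open>p\<close> to \<open>q\<close>.\<close>
    using farthest_dist_mono_along_orbit[OF S \<open>q \<in> \<Sigma>\<close> r orbit q] .
  finally have qq: "?d (- q) q \<le> ?d (- p) q" .
  have pp: "?d (- p) p < ?d (- p) q"
  proof (rule ccontr)
    assume "\<not> ?thesis"
    \<comment> \<open>If \<open>p\<close> is at least as far from \<open>- p\<close> as the farthest
      point \<open>q\<close>, it is itself a farthest point.\<close>
    then have "p \<in> ?f p" using q p(1) by (auto simp: farthest_antipodal_iff)
    then show False using not_fixed by simp
  qed
  have "- p \<in> \<Sigma>" using S p(1) by blast
  then have fin: "?d (- p) q < top"
    using \<open>q \<in> \<Sigma>\<close> intrinsic_dist_frontier_finite[OF P(1,2)] by (simp add: assms(4))
  have "?d (- p) q + ?d (- p) q \<le> ?d (- p) p + ?d (- q) q"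
    using intrinsic_dist_antipodal_crossing[OF P(1,3) assms(2) sym] by (simp add: assms(4))
  also have "\<dots> \<le> ?d (- p) p + ?d (- p) q" using qq by (rule add_left_mono)
  finally have "?d (- p) q \<le> ?d (- p) p"
    using fin by (auto simp: add.commute[of "?d (- p) p"] ennreal_add_left_cancel_le)
  with pp show False by simp
qed

end
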